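(* Suppose that $\tau\in\mathfrak S$ and that $\mathcal L=\{L_\alpha:\alpha\in\Lambda\}$ is a ladder system on $\omega_1$ such that, with the sets $B(\alpha)$ associated to $\tau$ and with $M_\alpha=\{\xi+1:\xi\in L_\alpha\}$, one has $\alpha=\sup[M_\alpha\cap B(\alpha)]=\sup[M_\alpha\setminus B(\alpha)]$ for every $\alpha\in\Lambda$. If in addition $\mathcal L$ witnesses $\clubsuit$, then $(\omega_1,\tau)$ is monotonically normal and $\omega_1$-compact but not $\sigma$-countably compact.
   Context: $\Lambda$ denotes the set of (nonzero) countable limit ordinals. For $\alpha\in\Lambda$, a ladder at $\alpha$ is an infinite subset $L_\alpha$ of $\alpha$ such that $|L_\alpha\cap\beta|<\omega$ for all $\beta\in\alpha$. A ladder system on $\omega_1$ is a family $\mathcal L=\{L_\alpha:\alpha\in\Lambda\}$ where each $L_\alpha$ is a ladder at $\alpha$. A ladder system $\mathcal L$ witnesses $\clubsuit$ if for every uncountable subset $S$ of $\omega_1$ there is $L_\alpha\in\mathcal L$ such that $L_\alpha\subset S$. $\mathfrak S$ designates the set of topologies $\tau$ on $\omega_1$ in which to each point $\alpha\in\omega_1$ there are associated a set $B(\alpha)\subset[0,\alpha]$ and sets $B(\alpha,\xi)=B(\alpha)\cap(\xi,\alpha]$ for each $\xi<\alpha$ (allowing $\xi=-1$ in case $\alpha=0$), such that: (1) $\{B(\alpha,\xi):\xi<\alpha\}$ is a base for the neighborhoods of $\alpha$; (2) if $\alpha\in\Lambda$ and $\beta>\alpha$, then there exists $\xi<\alpha$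 such that $B(\alpha,\xi)=B(\beta)\cap(\xi,\alpha]$ (in particular $\alpha\in B(\beta)$); (3) there is a ladder system $\mathcal L=\{L_\alpha:\alpha\in\Lambda\}$ such that if $M_\alpha=\{\xi+1:\xi\in L_\alpha\}$, then $\alpha=\sup[M_\alpha\cap B(\alpha)]=\sup[M_\alpha\setminus B(\alpha)]$ for all $\alpha\in\Lambda$. A space is $\omega_1$-compact if each of its closed discrete subspaces is countable, and $\sigma$-countably compact if it is the union of countably many countably compact subspaces. A space $X$ is monotonically normal if there is an operator $G$ assigning to each ordered pair $\langle F_0,F_1\rangle$ of disjoint closed subsets an open set $G(F_0,F_1)$ such that (a) $F_0\subset G(F_0,F_1)$; (b) if $F_0\subset F_0'$ and $F_1'\subset F_1$ then $G(F_0,F_1)\subset G(F_0',F_1')$; (c) $G(F_0,F_1)\cap G(F_1,F_0)=\emptyset$. *)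

theory Defs
  imports "HOL-Analysis.Analysis" "HOL-Library.Countable_Set_Type"
begin

text \<open>
  The first uncountable ordinal as a type: its order is the one of the cardinal
  successor of \<open>natLeq\<close>.  The last two lemmas of this part are the order-theoretic
  characterisation of \<open>\<omega>\<^sub>1\<close>.
\<close>

typedef omega1 = "Field (cardSuc natLeq)"
proof -
  have "infinite (Field (cardSuc natLeq))"
    by (simp add: cardSuc_finite[OF natLeq_Card_order] Field_natLeq)
  then show ?thesis
    by (metis ex_in_conv finite.emptyI)
qed

lemma well_order_on_cardSuc_natLeq:
  "well_order_on (Field (cardSuc natLeq)) (cardSuc natLeq)"
  using cardSuc_Card_order[OF natLeq_Card_order] card_order_on_well_order_on by blast

instantiation omega1 :: linorder
begin

definition less_eq_omega1 :: "omega1 \<Rightarrow> omega1 \<Rightarrow> bool"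
  where "x \<le> y \<longleftrightarrow> (Rep_omega1 x, Rep_omega1 y) \<in> cardSuc natLeq"

definition less_omega1 :: "omega1 \<Rightarrow> omega1 \<Rightarrow> bool"
  where "(x :: omega1) < y \<longleftrightarrow> x \<le> y \<and> x \<noteq> y"

instance
proof -
  have *: "refl_on (Field (cardSuc natLeq)) (cardSuc natLeq)" "trans (cardSuc natLeq)"
    "antisym (cardSuc natLeq)" "total_on (Field (cardSuc natLeq)) (cardSuc natLeq)"
    using well_order_on_cardSuc_natLeq
    by (auto simp: well_order_on_def linear_order_on_def partial_order_on_def preorder_on_def)
  have r: "x \<le> x" for x :: omega1
    using *(1) Rep_omega1 by (auto simp: less_eq_omega1_def refl_on_def)
  have t: "x \<le> z" if "x \<le> y" "y \<le> z" for x y z :: omega1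
    using that *(2) by (auto simp: less_eq_omega1_def dest: transD)
  have a: "x = y" if "x \<le> y" "y \<le> x" for x y :: omega1
    using that *(3) by (auto simp: less_eq_omega1_def Rep_omega1_inject dest: antisymD)
  have l: "x \<le> y \<or> y \<le> x" for x y :: omega1
    using *(4) r[of x] Rep_omega1[of x] Rep_omega1[of y]
    by (cases "x = y") (auto simp: less_eq_omega1_def total_on_def Rep_omega1_inject)
  show "OFCLASS(omega1, linorder_class)"
    by intro_classes (use r t a l in \<open>auto simp: less_omega1_def\<close>)
qed

end

instance omega1 :: wellorder
proof
  fix P :: "omega1 \<Rightarrow> bool" and a :: omega1
  assume step: "\<And>x. (\<And>y. y < x \<Longrightarrow> P y) \<Longrightarrow> P x"
  have "wf (cardSuc natLeq - Id)"
    using well_order_on_cardSuc_natLeq by (simp add: well_order_on_def)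
  then have "wf (inv_image (cardSuc natLeq - Id) Rep_omega1)"
    by (rule wf_inv_image)
  moreover have "inv_image (cardSuc natLeq - Id) Rep_omega1 = {(x, y). x < y}"
    by (auto simp: inv_image_def less_omega1_def less_eq_omega1_def Rep_omega1_inject)
  ultimately have "wf {(x :: omega1, y). x < y}"
    by simp
  then show "P a"
    by (induction a rule: wf_induct_rule) (use step in auto)
qed

instantiation omega1 :: "{order_bot, conditionally_complete_linorder}"
begin

definition bot_omega1 :: omega1
  where "bot = (LEAST x :: omega1. True)"

definition inf_omega1 :: "omega1 \<Rightarrow> omega1 \<Rightarrow> omega1"
  where "inf = (min :: omega1 \<Rightarrow> _)"

definition sup_omega1 :: "omega1 \<Rightarrow> omega1 \<Rightarrow> omega1"
  where "sup = (max :: omega1 \<Rightarrow> _)"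

definition Inf_omega1 :: "omega1 set \<Rightarrow> omega1"
  where "Inf X = (LEAST x :: omega1. x \<in> X)"

definition Sup_omega1 :: "omega1 set \<Rightarrow> omega1"
  where "Sup X = (LEAST b :: omega1. \<forall>x\<in>X. x \<le> b)"

instance
proof
  fix X :: "omega1 set" and x z :: omega1
  show "bot \<le> x"
    by (simp add: bot_omega1_def Least_le)
  show "Inf X \<le> x" if "x \<in> X"
    using that by (simp add: Inf_omega1_def Least_le)
  show "z \<le> Inf X" if "X \<noteq> {}" "\<And>x. x \<in> X \<Longrightarrow> z \<le> x"
    using that by (metis Inf_omega1_def LeastI ex_in_conv)
  show "x \<le> Sup X" if "x \<in> X" "bdd_above X"
  proof -
    from that(2) obtain b where "\<forall>x\<in>X. x \<le> b"
      by (auto simp: bdd_above_def)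
    from LeastI[of "\<lambda>b. \<forall>x\<in>X. x \<le> b", OF this] that(1) show ?thesis
      by (simp add: Sup_omega1_def)
  qed
  show "Sup X \<le> z" if "X \<noteq> {}" "\<And>x. x \<in> X \<Longrightarrow> x \<le> z"
    using that by (simp add: Sup_omega1_def Least_le)
qed (auto simp: inf_omega1_def sup_omega1_def)

end

lemma countable_lessThan_omega1:
  includes cardinal_syntax
  shows "countable {..<a :: omega1}"
proof -
  let ?r = "cardSuc natLeq"
  have co: "Card_order ?r"
    by (rule cardSuc_Card_order[OF natLeq_Card_order])
  have "|underS ?r (Rep_omega1 a)| <o ?r"
    by (rule card_of_underS[OF co Rep_omega1])
  then have "|underS ?r (Rep_omega1 a)| \<le>o natLeq"
    by (simp add: cardSuc_ordLeq_ordLess[OF natLeq_Card_order card_of_Card_order])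
  then have "countable (underS ?r (Rep_omega1 a))"
    by (simp add: countable_card_le_natLeq)
  moreover have "Rep_omega1 ` {..<a} \<subseteq> underS ?r (Rep_omega1 a)"
    by (auto simp: underS_def less_omega1_def less_eq_omega1_def Rep_omega1_inject)
  ultimately have "countable (Rep_omega1 ` {..<a})"
    by (rule countable_subset[rotated])
  then show ?thesis
    by (rule countable_image_inj_on) (auto simp: inj_on_def Rep_omega1_inject)
qed

lemma uncountable_UNIV_omega1:
  includes cardinal_syntax
  shows "uncountable (UNIV :: omega1 set)"
proof
  assume "countable (UNIV :: omega1 set)"
  then have "countable (range Rep_omega1)"
    by simp
  then have "countable (Field (cardSuc natLeq))"
    using type_definition.Rep_range[OF type_definition_omega1] by simp
  then have "|Field (cardSuc natLeq)| \<le>o natLeq"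
    by (simp add: countable_card_le_natLeq)
  moreover have "|Field (cardSuc natLeq)| =o cardSuc natLeq"
    by (rule card_of_Field_ordIso[OF cardSuc_Card_order[OF natLeq_Card_order]])
  ultimately have "cardSuc natLeq \<le>o natLeq"
    using ordIso_symmetric ordIso_ordLeq_trans by blast
  then show False
    using cardSuc_greater[OF natLeq_Card_order] not_ordLess_ordLeq by blast
qed

definition osucc :: "omega1 \<Rightarrow> omega1"
  where "osucc \<xi> = (LEAST \<eta>. \<xi> < \<eta>)"

definition Lambda :: "omega1 set"
  where "Lambda = {\<alpha>. \<alpha> \<noteq> bot \<and> (\<forall>\<xi>. \<alpha> \<noteq> osucc \<xi>)}"

definition ladder_at :: "omega1 \<Rightarrow> omega1 set \<Rightarrow> bool"
  where "ladder_at \<alpha> A \<longleftrightarrow> A \<subseteq> {..<\<alpha>} \<and> infinite A \<and> (\<forall>\<beta><\<alpha>. finite (A \<inter> {..<\<beta>}))"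

text \<open>A ladder system is an indexed family; its values outside \<open>Lambda\<close> are irrelevant.\<close>

definition ladder_system :: "(omega1 \<Rightarrow> omega1 set) \<Rightarrow> bool"
  where "ladder_system L \<longleftrightarrow> (\<forall>\<alpha>\<in>Lambda. ladder_at \<alpha> (L \<alpha>))"

definition witnesses_club :: "(omega1 \<Rightarrow> omega1 set) \<Rightarrow> bool"
  where "witnesses_club L \<longleftrightarrow> (\<forall>S. uncountable S \<longrightarrow> (\<exists>\<alpha>\<in>Lambda. L \<alpha> \<subseteq> S))"

text \<open>
  Here \<open>M \<alpha> = osucc ` L \<alpha>\<close>.  Both sets are bounded by \<open>\<alpha>\<close>, so \<open>Sup\<close> is the genuine
  supremum (with \<open>Sup {} = bot\<close>).
\<close>

definition ladders_split :: "(omega1 \<Rightarrow> omega1 set) \<Rightarrow> (omega1 \<Rightarrow> omega1 set) \<Rightarrow> bool"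
  where "ladders_split B L \<longleftrightarrow>
    (\<forall>\<alpha>\<in>Lambda. \<alpha> = Sup (osucc ` L \<alpha> \<inter> B \<alpha>) \<and> \<alpha> = Sup (osucc ` L \<alpha> - B \<alpha>))"

text \<open>
  The family of the sets \<open>B(\<alpha>,\<xi>) = B(\<alpha>) \<inter> (\<xi>,\<alpha>]\<close> with \<open>\<xi> < \<alpha>\<close>; for \<open>\<alpha> = 0\<close> the only
  admissible index is \<open>\<xi> = -1\<close>, which gives \<open>B(0) \<inter> [0,0]\<close>.
\<close>

definition basic_nbhds :: "(omega1 \<Rightarrow> omega1 set) \<Rightarrow> omega1 \<Rightarrow> omega1 set set"
  where "basic_nbhds B \<alpha> =
    (if \<alpha> = bot then {B \<alpha> \<inter> {..\<alpha>}} else {B \<alpha> \<inter> {\<xi><..\<alpha>} | \<xi>. \<xi> < \<alpha>})"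

text \<open>Neighbourhoods, and hence the members of a base for them, need not be open.\<close>

definition neighbourhood_of :: "'a topology \<Rightarrow> 'a \<Rightarrow> 'a set \<Rightarrow> bool"
  where "neighbourhood_of X x N \<longleftrightarrow>
    N \<subseteq> topspace X \<and> (\<exists>U. openin X U \<and> x \<in> U \<and> U \<subseteq> N)"

definition neighbourhoods_base :: "'a topology \<Rightarrow> 'a \<Rightarrow> 'a set set \<Rightarrow> bool"
  where "neighbourhoods_base X x \<N> \<longleftrightarrow>
    (\<forall>N\<in>\<N>. neighbourhood_of X x N) \<and>
    (\<forall>W. neighbourhood_of X x W \<longrightarrow> (\<exists>N\<in>\<N>. N \<subseteq> W))"

definition associated_sets :: "omega1 topology \<Rightarrow> (omega1 \<Rightarrow> omega1 set) \<Rightarrow> bool"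
  where "associated_sets \<tau> B \<longleftrightarrow>
    topspace \<tau> = UNIV \<and>
    (\<forall>\<alpha>. B \<alpha> \<subseteq> {..\<alpha>}) \<and>
    (\<forall>\<alpha>. neighbourhoods_base \<tau> \<alpha> (basic_nbhds B \<alpha>)) \<and>
    (\<forall>\<alpha>\<in>Lambda. \<forall>\<beta>>\<alpha>. \<exists>\<xi><\<alpha>. B \<alpha> \<inter> {\<xi><..\<alpha>} = B \<beta> \<inter> {\<xi><..\<alpha>}) \<and>
    (\<exists>L. ladder_system L \<and> ladders_split B L)"

definition frakS :: "omega1 topology set"
  where "frakS = {\<tau>. \<exists>B. associated_sets \<tau> B}"

definition omega1_compact :: "'a topology \<Rightarrow> bool"
  where "omega1_compact X \<longleftrightarrow>
    (\<forall>D. closedin X D \<and> subtopology X D = discrete_topology D \<longrightarrow> countable D)"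

definition countably_compact_space :: "'a topology \<Rightarrow> bool"
  where "countably_compact_space X \<longleftrightarrow>
    (\<forall>\<U>. countable \<U> \<and> (\<forall>U\<in>\<U>. openin X U) \<and> topspace X \<subseteq> \<Union>\<U> \<longrightarrow>
      (\<exists>\<F>. finite \<F> \<and> \<F> \<subseteq> \<U> \<and> topspace X \<subseteq> \<Union>\<F>))"

definition sigma_countably_compact :: "'a topology \<Rightarrow> bool"
  where "sigma_countably_compact X \<longleftrightarrow>
    (\<exists>\<C>. countable \<C> \<and> (\<forall>C\<in>\<C>. countably_compact_space (subtopology X C)) \<and>
      \<Union>\<C> = topspace X)"

definition disjoint_closed_pair :: "'a topology \<Rightarrow> 'a set \<Rightarrow> 'a set \<Rightarrow> bool"
  where "disjoint_closed_pair X F0 F1 \<longleftrightarrow> closedin X F0 \<and> closedin X F1 \<and> disjnt F0 F1"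

text \<open>The values of \<open>G\<close> on pairs that are not disjoint closed pairs are irrelevant.\<close>

definition monotonically_normal_space :: "'a topology \<Rightarrow> bool"
  where "monotonically_normal_space X \<longleftrightarrow>
    (\<exists>G.
      (\<forall>F0 F1. disjoint_closed_pair X F0 F1 \<longrightarrow>
        openin X (G F0 F1) \<and> F0 \<subseteq> G F0 F1 \<and> G F0 F1 \<inter> G F1 F0 = {}) \<and>
      (\<forall>F0 F1 F0' F1'. disjoint_closed_pair X F0 F1 \<and> disjoint_closed_pair X F0' F1' \<and>
        F0 \<subseteq> F0' \<and> F1' \<subseteq> F1 \<longrightarrow> G F0 F1 \<subseteq> G F0' F1'))"

end

theory Submission
  imports Defs
begin

text \<open>
  A topology in the class considered here is determined by its behaviour at limit ordinals:
  \<open>0\<close> and the successors are isolated, and every limit \<open>\<alpha> \<le> \<beta>\<close> belongs to \<open>B \<beta>\<close>.  So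
  the limits inherit the same topology as from the order topology on \<open>\<omega>\<^sub>1\<close>, while the sets
  \<open>B \<alpha>\<close> may omit successors.

  \<^emph>\<open>Monotone normality.\<close>  Attach to a point \<open>x\<close> of an open set \<open>U\<close> the open set \<open>H x U\<close> that is
  \<open>{x}\<close> for isolated \<open>x\<close> and otherwise the union of the basic neighbourhoods of \<open>x\<close> inside
  \<open>U\<close>.  If basic neighbourhoods of two limits \<open>\<alpha> < \<beta>\<close> meet, then the one of \<open>\<beta>\<close> reaches below
  \<open>\<alpha>\<close> and so contains the limit \<open>\<alpha>\<close>.  This is Borges's criterion for monotone normality.

  \<^emph>\<open>\<open>\<omega>\<^sub>1\<close>-compactness.\<close>  An uncountable set has uncountably many successors or uncountably many
  limits.  In the first case \<open>\<clubsuit>\<close>, applied to the predecessors, puts some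
  \<open>osucc ` L \<alpha>\<close> into the set, and the part of this set inside \<open>B \<alpha>\<close> accumulates at \<open>\<alpha>\<close>.  In
  the second case \<open>\<clubsuit>\<close>, applied to the limits themselves, gives an \<open>\<alpha>\<close> in which they
  are cofinal; since \<open>B \<alpha>\<close> omits no limit, they accumulate at \<open>\<alpha>\<close> in the topology too.

  \<^emph>\<open>Failure of \<open>\<sigma>\<close>-countable compactness.\<close>  One of countably many pieces covering \<open>\<omega>\<^sub>1\<close> has
  uncountably many successors, hence contains some \<open>osucc ` L \<alpha>\<close>.  The part of this set
  outside \<open>B \<alpha>\<close> is infinite, consists of isolated points and has no limit point at all: not
  below \<open>\<alpha>\<close>, because ladders at \<open>\<alpha>\<close> have finite initial segments, not \<open>\<alpha>\<close> itself, because the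
  set misses \<open>B \<alpha>\<close>, and none above \<open>\<alpha>\<close>, because the set is bounded by \<open>\<alpha>\<close>.
  So that piece is not countably compact.
\<close>

section \<open>Successors, limits and ladders\<close>

text \<open>There is no largest element, because initial segments are countable.\<close>

lemma less_osucc: "\<xi> < osucc \<xi>"
proof -
  have "countable {..\<xi>}"
    using countable_lessThan_omega1[of \<xi>] by (simp flip: ivl_disj_un_singleton(2))
  then have "{..\<xi>} \<noteq> UNIV"
    using uncountable_UNIV_omega1 by auto
  then obtain \<eta> where "\<xi> < \<eta>"
    by (auto simp: set_eq_iff not_le)
  then show ?thesis
    unfolding osucc_def by (rule LeastI)
qed

lemma osucc_le_iff: "osucc \<xi> \<le> \<eta> \<longleftrightarrow> \<xi> < \<eta>"
  using less_osucc[of \<xi>] by (auto simp: osucc_def intro: Least_le)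

lemma inj_osucc: "inj osucc"
  by (rule injI) (metis less_osucc osucc_le_iff nle_le not_le)

lemma osucc_notin_Lambda: "osucc \<xi> \<notin> Lambda"
  by (auto simp: Lambda_def)

lemma osucc_less_limit: "\<alpha> \<in> Lambda \<Longrightarrow> \<xi> < \<alpha> \<Longrightarrow> osucc \<xi> < \<alpha>"
  using osucc_le_iff[of \<xi> \<alpha>] by (auto simp: Lambda_def less_le)

lemma bot_less_limit: "\<alpha> \<in> Lambda \<Longrightarrow> bot < \<alpha>"
  by (simp add: Lambda_def bot.not_eq_extremum)

lemma not_limit_cases:
  assumes "x \<notin> Lambda"
  obtains "x = bot" | \<xi> where "x = osucc \<xi>"
  using assms by (auto simp: Lambda_def)

lemma ladder_cofinal:
  assumes "\<alpha> \<in> Lambda" "ladder_at \<alpha> A" "\<xi> < \<alpha>"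
  shows "\<exists>\<eta>\<in>A. \<xi> < \<eta> \<and> \<eta> < \<alpha>"
proof (rule ccontr)
  assume *: "\<not> ?thesis"
  have sub: "A \<subseteq> {..<\<alpha>}" and inf: "infinite A"
    using assms(2) by (auto simp: ladder_at_def)
  have "A \<inter> {..<osucc \<xi>} = A"
    using * sub less_osucc[of \<xi>] by (force simp: not_less)
  moreover have "finite (A \<inter> {..<osucc \<xi>})"
    using assms(2) osucc_less_limit[OF assms(1,3)] by (simp add: ladder_at_def)
  ultimately show False
    using inf by simp
qed

lemma cofinal_if_Sup_eq_limit:
  assumes "\<alpha> \<in> Lambda" "\<alpha> = Sup A" "\<xi> < (\<alpha> :: omega1)"
  shows "\<exists>x\<in>A. \<xi> < x"
proof (rule ccontr)
  assume "\<not> ?thesis"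
  then have "\<forall>x\<in>A. x \<le> \<xi>"
    by (auto simp: not_less)
  then have "Sup A \<le> \<xi>"
    by (auto simp: Sup_omega1_def intro: Least_le)
  with assms show False
    by auto
qed

lemma infinite_if_Sup_eq_limit:
  assumes "\<alpha> \<in> Lambda" "\<alpha> = Sup A" "A \<subseteq> {..<(\<alpha> :: omega1)}"
  shows "infinite A"
proof
  assume fin: "finite A"
  have "A \<noteq> {}"
    using cofinal_if_Sup_eq_limit[OF assms(1,2) bot_less_limit[OF assms(1)]] by auto
  then have "Max A < \<alpha>"
    using fin assms(3) by auto
  from cofinal_if_Sup_eq_limit[OF assms(1,2) this] fin show False
    by (auto dest: Max_ge)
qed

text \<open>
  Applying \<open>\<clubsuit>\<close> to the predecessors gives guesses by shifted ladders, whose points are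
  isolated in the topologies considered below.
\<close>

lemma club_guesses_successors:
  assumes "witnesses_club L" "uncountable (T \<inter> range osucc)"
  obtains \<alpha> where "\<alpha> \<in> Lambda" "osucc ` L \<alpha> \<subseteq> T"
proof -
  have "T \<inter> range osucc = osucc ` (osucc -` T)"
    by auto
  then have "uncountable (osucc -` T)"
    using assms(2) by (metis countable_image)
  then obtain \<alpha> where "\<alpha> \<in> Lambda" "L \<alpha> \<subseteq> osucc -` T"
    using assms(1) by (auto simp: witnesses_club_def)
  then show thesis
    using that by blast
qed

section \<open>The topology seen from limit ordinals\<close>

text \<open>
  Only limits impose a condition on an open set: the basic neighbourhood
  \<open>B (osucc \<xi>) \<inter> {\<xi><..osucc \<xi>}\<close> is a singleton, and so is the only one at \<open>bot\<close>.
\<close>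

lemma openin_iff_limits:
  assumes "associated_sets \<tau> B"
  shows "openin \<tau> U \<longleftrightarrow> (\<forall>\<alpha>\<in>U \<inter> Lambda. \<exists>\<xi><\<alpha>. B \<alpha> \<inter> {\<xi><..\<alpha>} \<subseteq> U)"
proof
  have top: "topspace \<tau> = UNIV" and base: "\<And>\<alpha>. neighbourhoods_base \<tau> \<alpha> (basic_nbhds B \<alpha>)"
    using assms by (auto simp: associated_sets_def)
  show "\<forall>\<alpha>\<in>U \<inter> Lambda. \<exists>\<xi><\<alpha>. B \<alpha> \<inter> {\<xi><..\<alpha>} \<subseteq> U" if U: "openin \<tau> U"
  proof
    fix \<alpha> assume \<alpha>: "\<alpha> \<in> U \<inter> Lambda"
    then have "neighbourhood_of \<tau> \<alpha> U"
      using U top by (auto simp: neighbourhood_of_def)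
    then obtain N where "N \<in> basic_nbhds B \<alpha>" "N \<subseteq> U"
      using base[of \<alpha>] by (auto simp: neighbourhoods_base_def)
    then show "\<exists>\<xi><\<alpha>. B \<alpha> \<inter> {\<xi><..\<alpha>} \<subseteq> U"
      using \<alpha> by (auto simp: basic_nbhds_def Lambda_def)
  qed
  show "openin \<tau> U" if U: "\<forall>\<alpha>\<in>U \<inter> Lambda. \<exists>\<xi><\<alpha>. B \<alpha> \<inter> {\<xi><..\<alpha>} \<subseteq> U"
  proof (subst openin_subopen, intro ballI)
    fix x assume x: "x \<in> U"
    have "\<exists>N\<in>basic_nbhds B x. N \<subseteq> U"
    proof (cases "x \<in> Lambda")
      case True
      then obtain \<xi> where "\<xi> < x" "B x \<inter> {\<xi><..x} \<subseteq> U"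
        using U x by blast
      moreover have "x \<noteq> bot"
        using True by (simp add: Lambda_def)
      ultimately show ?thesis
        by (auto simp: basic_nbhds_def)
    next
      case False
      then show ?thesis
      proof (cases rule: not_limit_cases)
        case 1
        then show ?thesis
          using x by (simp add: basic_nbhds_def bot.extremum_unique subset_iff)
      next
        case (2 \<xi>)
        have "B x \<inter> {\<xi><..x} \<subseteq> U"
          using x 2 osucc_le_iff by (metis IntE antisym greaterThanAtMost_iff subsetI)
        moreover have "\<xi> < x"
          using 2 less_osucc by simp
        moreover have "x \<noteq> bot"
          using calculation(2) by auto
        ultimately show ?thesis
          by (auto simp: basic_nbhds_def)
      qed
    qed
    then show "\<exists>T. openin \<tau> T \<and> x \<in> T \<and> T \<subseteq> U"
      using base[of x] unfolding neighbourhoods_base_def neighbourhood_of_def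
      by (meson order_trans)
  qed
qed

lemma openin_singleton_if_not_limit:
  "associated_sets \<tau> B \<Longrightarrow> x \<notin> Lambda \<Longrightarrow> openin \<tau> {x}"
  by (simp add: openin_iff_limits)

text \<open>
  For \<open>\<alpha> = \<beta>\<close> this holds because \<open>B \<alpha>\<close> contains a neighbourhood of \<open>\<alpha>\<close>; for
  \<open>\<alpha> < \<beta>\<close> because \<open>B \<alpha>\<close> and \<open>B \<beta>\<close> agree just below and at \<open>\<alpha>\<close>.
\<close>

lemma limit_in_associated_set:
  assumes "associated_sets \<tau> B" "\<alpha> \<in> Lambda" "\<alpha> \<le> \<beta>"
  shows "\<alpha> \<in> B \<beta>"
proof -
  have "B \<alpha> \<inter> {bot<..\<alpha>} \<in> basic_nbhds B \<alpha>"
    using bot_less_limit[OF assms(2)] by (auto simp: basic_nbhds_def)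
  then have "neighbourhood_of \<tau> \<alpha> (B \<alpha> \<inter> {bot<..\<alpha>})"
    using assms(1) by (auto simp: associated_sets_def neighbourhoods_base_def)
  then have self: "\<alpha> \<in> B \<alpha>"
    by (auto simp: neighbourhood_of_def)
  show ?thesis
  proof (cases "\<alpha> = \<beta>")
    case False
    then obtain \<xi> where "\<xi> < \<alpha>" "B \<alpha> \<inter> {\<xi><..\<alpha>} = B \<beta> \<inter> {\<xi><..\<alpha>}"
      using assms unfolding associated_sets_def by (metis order_less_le)
    then have "\<alpha> \<in> B \<beta> \<inter> {\<xi><..\<alpha>}"
      using self by (metis IntI greaterThanAtMost_iff order_refl)
    then show ?thesis
      by simp
  qed (use self in simp)
qed

lemma openin_associated_interval:
  assumes "associated_sets \<tau> B"
  shows "openin \<tau> (B \<beta> \<inter> {\<xi><..\<beta>})"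
  unfolding openin_iff_limits[OF assms]
proof
  fix \<alpha> assume \<alpha>: "\<alpha> \<in> B \<beta> \<inter> {\<xi><..\<beta>} \<inter> Lambda"
  show "\<exists>\<zeta><\<alpha>. B \<alpha> \<inter> {\<zeta><..\<alpha>} \<subseteq> B \<beta> \<inter> {\<xi><..\<beta>}"
  proof (cases "\<alpha> = \<beta>")
    case True
    then show ?thesis
      using \<alpha> by auto
  next
    case False
    then obtain \<zeta> where \<zeta>: "\<zeta> < \<alpha>" "B \<alpha> \<inter> {\<zeta><..\<alpha>} = B \<beta> \<inter> {\<zeta><..\<alpha>}"
      using assms \<alpha> unfolding associated_sets_def
      by (metis IntE greaterThanAtMost_iff order_less_le)
    have "B \<alpha> \<inter> {max \<xi> \<zeta><..\<alpha>} \<subseteq> B \<beta> \<inter> {\<xi><..\<beta>}"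
    proof
      fix x assume x: "x \<in> B \<alpha> \<inter> {max \<xi> \<zeta><..\<alpha>}"
      then have "x \<in> B \<beta> \<inter> {\<zeta><..\<alpha>}"
        unfolding \<zeta>(2)[symmetric] by auto
      then show "x \<in> B \<beta> \<inter> {\<xi><..\<beta>}"
        using x \<alpha> by auto
    qed
    then show ?thesis
      using \<zeta>(1) \<alpha> by (intro exI[of _ "max \<xi> \<zeta>"]) auto
  qed
qed

section \<open>Monotone normality\<close>

text \<open>
  Borges's criterion: disjoint closed sets are separated by the unions of the sets
  attached to their points, each taken relative to the complement of the other closed set.
\<close>

lemma monotonically_normal_if_pointwise:
  fixes H :: "'a \<Rightarrow> 'a set \<Rightarrow> 'a set"
  assumes nbhd: "\<And>x U. openin X U \<Longrightarrow> x \<in> U \<Longrightarrow> openin X (H x U) \<and> x \<in> H x U"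
    and mono: "\<And>x U V. U \<subseteq> V \<Longrightarrow> H x U \<subseteq> H x V"
    and sep: "\<And>x y U V. x \<in> U \<Longrightarrow> y \<in> V \<Longrightarrow> H x U \<inter> H y V \<noteq> {} \<Longrightarrow> x \<in> V \<or> y \<in> U"
  shows "monotonically_normal_space X"
proof -
  define G where "G F0 F1 = (\<Union>x\<in>F0. H x (topspace X - F1))" for F0 F1
  have "openin X (G F0 F1) \<and> F0 \<subseteq> G F0 F1 \<and> G F0 F1 \<inter> G F1 F0 = {}"
    if pair: "disjoint_closed_pair X F0 F1" for F0 F1
  proof -
    have op: "openin X (topspace X - F0)" "openin X (topspace X - F1)"
      and in_compl: "\<And>x. x \<in> F0 \<Longrightarrow> x \<in> topspace X - F1" "\<And>y. y \<in> F1 \<Longrightarrow> y \<in> topspace X - F0"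
      using pair by (auto simp: disjoint_closed_pair_def disjnt_iff dest: closedin_subset)
    have "H x (topspace X - F1) \<inter> H y (topspace X - F0) = {}" if "x \<in> F0" "y \<in> F1" for x y
      using sep[OF in_compl(1)[OF that(1)] in_compl(2)[OF that(2)]] that by auto
    then have "G F0 F1 \<inter> G F1 F0 = {}"
      unfolding G_def by blast
    moreover have "openin X (G F0 F1)" "F0 \<subseteq> G F0 F1"
      unfolding G_def using nbhd[OF op(2) in_compl(1)] by blast+
    ultimately show ?thesis
      by simp
  qed
  moreover have "G F0 F1 \<subseteq> G F0' F1'" if "F0 \<subseteq> F0'" "F1' \<subseteq> F1" for F0 F1 F0' F1'
    unfolding G_def using that by (intro UN_mono mono) auto
  ultimately show ?thesis
    unfolding monotonically_normal_space_def by (intro exI[of _ G]) auto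
qed

lemma monotonically_normal_associated:
  assumes as: "associated_sets \<tau> B"
  shows "monotonically_normal_space \<tau>"
proof -
  \<comment> \<open>Taking all basic neighbourhoods inside \<open>U\<close> rather than choosing one makes \<open>H\<close> monotone.\<close>
  define H where "H x U = (if x \<in> Lambda then \<Union>{B x \<inter> {\<xi><..x} |\<xi>. \<xi> < x \<and> B x \<inter> {\<xi><..x} \<subseteq> U} else {x})"
    for x U
  have H_subset: "H x U \<subseteq> U" if "x \<in> U" for x U
    using that by (auto simp: H_def)
  have H_le: "z \<le> x" if "z \<in> H x U" for x z U
    using that by (auto simp: H_def split: if_splits)
  \<comment> \<open>No limit between a point of \<open>H \<beta> V\<close> and \<open>\<beta>\<close> is missing from \<open>H \<beta> V\<close>.\<close>
  have H_up: "\<alpha> \<in> H \<beta> V" if z: "z \<in> H \<beta> V" "z \<le> \<alpha>" "\<alpha> < \<beta>" "\<alpha> \<in> Lambda" for z \<alpha> \<beta> V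
  proof -
    have \<beta>: "\<beta> \<in> Lambda"
      using z by (auto simp: H_def split: if_splits)
    then obtain \<xi> where \<xi>: "\<xi> < \<beta>" "B \<beta> \<inter> {\<xi><..\<beta>} \<subseteq> V" "z \<in> B \<beta> \<inter> {\<xi><..\<beta>}"
      using z(1) by (auto simp: H_def)
    have "\<alpha> \<in> B \<beta> \<inter> {\<xi><..\<beta>}"
      using \<xi>(3) z(2,3) limit_in_associated_set[OF as z(4), of \<beta>] by auto
    then show ?thesis
      using \<beta> \<xi>(1,2) unfolding H_def by (auto simp del: Int_iff)
  qed
  have less_case: "x \<in> V" if "x < y" "y \<in> V" "H x U \<inter> H y V \<noteq> {}" for x y U V
  proof -
    from that(3) obtain z where z: "z \<in> H x U" "z \<in> H y V"
      by auto
    have "x \<in> H y V"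
    proof (cases "x \<in> Lambda")
      case True
      then show ?thesis
        using H_up[OF z(2) H_le[OF z(1)] that(1)] by simp
    qed (use z in \<open>simp add: H_def\<close>)
    then show ?thesis
      using H_subset[OF that(2)] by blast
  qed
  show ?thesis
  proof (rule monotonically_normal_if_pointwise[where H = H])
    fix x U assume U: "openin \<tau> U" "x \<in> U"
    show "openin \<tau> (H x U) \<and> x \<in> H x U"
    proof (cases "x \<in> Lambda")
      case True
      then obtain \<xi> where "\<xi> < x" "B x \<inter> {\<xi><..x} \<subseteq> U"
        using U openin_iff_limits[OF as] by blast
      moreover from this have "x \<in> B x \<inter> {\<xi><..x}"
        using limit_in_associated_set[OF as True order_refl] by simp
      ultimately have "x \<in> H x U"
        using True unfolding H_def by (auto simp del: Int_iff)
      moreover have "openin \<tau> (H x U)"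
        using True openin_associated_interval[OF as] by (auto simp: H_def)
      ultimately show ?thesis
        by simp
    qed (use openin_singleton_if_not_limit[OF as] in \<open>simp add: H_def\<close>)
  next
    fix x and U V :: "omega1 set" assume "U \<subseteq> V"
    then show "H x U \<subseteq> H x V"
      by (auto simp: H_def)
  next
    fix x y U V assume *: "x \<in> U" "y \<in> V" "H x U \<inter> H y V \<noteq> {}"
    consider "x < y" | "x = y" | "y < x"
      by fastforce
    then show "x \<in> V \<or> y \<in> U"
    proof cases
      case 1
      then show ?thesis
        using less_case[OF 1 *(2,3)] by simp
    next
      case 2
      then show ?thesis
        using *(1) by simp
    next
      case 3
      have "H y V \<inter> H x U \<noteq> {}"
        using *(3) by (simp add: Int_commute)
      then show ?thesis
        using less_case[OF 3 *(1)] by simp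
    qed
  qed
qed

section \<open>Closed discrete sets are countable\<close>

text \<open>
  Closedness would put the accumulation point \<open>\<alpha>\<close> into \<open>D\<close>, where discreteness isolates it.
\<close>

lemma accumulation_not_closed_discrete:
  assumes as: "associated_sets \<tau> B" and \<alpha>: "\<alpha> \<in> Lambda"
    and acc: "\<And>\<xi>. \<xi> < \<alpha> \<Longrightarrow> \<exists>d\<in>D \<inter> B \<alpha>. \<xi> < d \<and> d < \<alpha>"
    and clo: "closedin \<tau> D" and disc: "subtopology \<tau> D = discrete_topology D"
  shows False
proof -
  have meets: "\<exists>d\<in>D \<inter> U. d \<noteq> \<alpha>" if U: "openin \<tau> U" "\<alpha> \<in> U" for U
  proof -
    have "\<alpha> \<in> U \<inter> Lambda"
      using U \<alpha> by simp
    then obtain \<xi> where \<xi>: "\<xi> < \<alpha>" "B \<alpha> \<inter> {\<xi><..\<alpha>} \<subseteq> U"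
      using openin_iff_limits[OF as, THEN iffD1, OF U(1)] by blast
    obtain d where d: "d \<in> D" "d \<in> B \<alpha>" "\<xi> < d" "d < \<alpha>"
      using acc[OF \<xi>(1)] by auto
    then have "d \<in> B \<alpha> \<inter> {\<xi><..\<alpha>}"
      by simp
    with \<xi>(2) d(1,4) show ?thesis
      by (intro bexI[of _ d]) auto
  qed
  have "topspace \<tau> = UNIV"
    using as by (simp add: associated_sets_def)
  then have "\<alpha> \<in> D"
    using clo meets[of "topspace \<tau> - D"] by (auto simp: closedin_def)
  then have "openin (subtopology \<tau> D) {\<alpha>}"
    by (simp add: disc)
  then obtain U where "openin \<tau> U" "{\<alpha>} = U \<inter> D"
    by (auto simp: openin_subtopology)
  then show False
    using meets[of U] by blast
qed

lemma omega1_compact_associated: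
  assumes as: "associated_sets \<tau> B" and lad: "ladder_system L"
    and split: "ladders_split B L" and club: "witnesses_club L"
  shows "omega1_compact \<tau>"
  unfolding omega1_compact_def
proof (intro allI impI, rule ccontr)
  fix D assume D: "closedin \<tau> D \<and> subtopology \<tau> D = discrete_topology D" and unc: "uncountable D"
  have "D \<subseteq> (D \<inter> range osucc) \<union> (D \<inter> Lambda) \<union> {bot}"
    by (auto simp: Lambda_def)
  then have "uncountable (D \<inter> range osucc) \<or> uncountable (D \<inter> Lambda)"
    using unc countable_subset by (metis countable_Un countable_empty countable_insert)
  then show False
  proof
    assume "uncountable (D \<inter> range osucc)"
    then obtain \<alpha> where \<alpha>: "\<alpha> \<in> Lambda" and sub: "osucc ` L \<alpha> \<subseteq> D"
      using club_guesses_successors[OF club] by blast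
    have below: "osucc ` L \<alpha> \<subseteq> {..<\<alpha>}"
      using lad \<alpha> osucc_less_limit[OF \<alpha>] by (auto simp: ladder_system_def ladder_at_def)
    have "\<exists>d\<in>D \<inter> B \<alpha>. \<xi> < d \<and> d < \<alpha>" if "\<xi> < \<alpha>" for \<xi>
      using cofinal_if_Sup_eq_limit[OF \<alpha> _ that, of "osucc ` L \<alpha> \<inter> B \<alpha>"] split \<alpha> sub below
      by (fastforce simp: ladders_split_def)
    then show False
      using accumulation_not_closed_discrete[OF as \<alpha>] D by blast
  next
    assume "uncountable (D \<inter> Lambda)"
    then obtain \<alpha> where \<alpha>: "\<alpha> \<in> Lambda" and sub: "L \<alpha> \<subseteq> D \<inter> Lambda"
      using club by (auto simp: witnesses_club_def)
    have "\<exists>d\<in>D \<inter> B \<alpha>. \<xi> < d \<and> d < \<alpha>" if \<xi>: "\<xi> < \<alpha>" for \<xi>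
    proof -
      have "ladder_at \<alpha> (L \<alpha>)"
        using lad \<alpha> by (simp add: ladder_system_def)
      then obtain d where d: "d \<in> L \<alpha>" "\<xi> < d" "d < \<alpha>"
        using ladder_cofinal[OF \<alpha> _ \<xi>] by blast
      then have "d \<in> B \<alpha>"
        using sub by (intro limit_in_associated_set[OF as]) auto
      with d sub show ?thesis
        by auto
    qed
    then show False
      using accumulation_not_closed_discrete[OF as \<alpha>] D by blast
  qed
qed

section \<open>Countably many countably compact pieces do not suffice\<close>

text \<open>The singletons of the points of \<open>A\<close> and the complement of \<open>A\<close> form a bad cover.\<close>

lemma not_countably_compact_if_isolated_points:
  assumes "A \<subseteq> C" "infinite A" "countable A" "closedin X A"
    and iso: "\<And>a. a \<in> A \<Longrightarrow> openin X {a}"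
  shows "\<not> countably_compact_space (subtopology X C)"
proof
  assume cc: "countably_compact_space (subtopology X C)"
  define \<U> where "\<U> = insert (C \<inter> (topspace X - A)) ((\<lambda>a. {a}) ` A)"
  have "openin (subtopology X C) {a}" if "a \<in> A" for a
    using openin_subtopology_Int[OF iso[OF that], of C] that assms(1) by (simp add: subset_iff)
  moreover have "openin (subtopology X C) (C \<inter> (topspace X - A))"
    using assms(4) by (intro openin_subtopology_Int2) auto
  moreover have "topspace (subtopology X C) \<subseteq> \<Union>\<U>"
    by (auto simp: \<U>_def)
  moreover have "countable \<U>"
    using assms(3) by (simp add: \<U>_def)
  ultimately obtain \<F> where \<F>: "finite \<F>" "\<F> \<subseteq> \<U>" "topspace (subtopology X C) \<subseteq> \<Union>\<F>"
    using cc[unfolded countably_compact_space_def, rule_format, of \<U>] by (auto simp: \<U>_def)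
  have top: "A \<subseteq> topspace (subtopology X C)"
    using assms(1) closedin_subset[OF assms(4)] by auto
  \<comment> \<open>A point of \<open>A\<close> lies in no member of the cover but its own singleton.\<close>
  have "(\<lambda>a. {a}) ` A \<subseteq> \<F>"
  proof (intro image_subsetI)
    fix a assume a: "a \<in> A"
    then obtain U where "U \<in> \<F>" "a \<in> U"
      using \<F>(3) top by blast
    moreover from this have "U = {a}"
      using \<F>(2) a unfolding \<U>_def by blast
    ultimately show "{a} \<in> \<F>"
      by simp
  qed
  then have "finite ((\<lambda>a. {a}) ` A)"
    using \<F>(1) finite_subset by blast
  then have "finite A"
    by (rule finite_imageD) (simp add: inj_on_def)
  with assms(2) show False ..
qed

text \<open>
  The only limit at which the shifted ladder could accumulate is \<open>\<alpha>\<close>, and there the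
  neighbourhood \<open>B \<alpha>\<close> shields it from the part that was removed.
\<close>

lemma closedin_shifted_ladder_outside:
  assumes as: "associated_sets \<tau> B" and \<alpha>: "\<alpha> \<in> Lambda" and lad: "ladder_at \<alpha> A"
  shows "closedin \<tau> (osucc ` A - B \<alpha>)"
proof -
  let ?M = "osucc ` A - B \<alpha>"
  have A: "A \<subseteq> {..<\<alpha>}" and fin: "\<And>\<beta>. \<beta> < \<alpha> \<Longrightarrow> finite (A \<inter> {..<\<beta>})"
    using lad by (auto simp: ladder_at_def)
  have below: "\<And>x. x \<in> ?M \<Longrightarrow> x < \<alpha>"
    using A osucc_less_limit[OF \<alpha>] by auto
  have "openin \<tau> (- ?M)"
    unfolding openin_iff_limits[OF as]
  proof
    fix \<beta> assume "\<beta> \<in> - ?M \<inter> Lambda"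
    then have \<beta>: "\<beta> \<in> Lambda"
      by simp
    consider "\<beta> < \<alpha>" | "\<beta> = \<alpha>" | "\<alpha> < \<beta>"
      by fastforce
    then show "\<exists>\<xi><\<beta>. B \<beta> \<inter> {\<xi><..\<beta>} \<subseteq> - ?M"
    proof cases
      case 1
      define F where "F = insert bot (osucc ` (A \<inter> {..<\<beta>}))"
      have F: "finite F" "F \<noteq> {}" "F \<subseteq> {..<\<beta>}"
        using fin[OF 1] osucc_less_limit[OF \<beta>] bot_less_limit[OF \<beta>] by (auto simp: F_def)
      have "x \<le> Max F" if "x \<in> ?M" "x \<le> \<beta>" for x
        using that F(1) by (intro Max_ge) (auto simp: F_def osucc_le_iff)
      then have "B \<beta> \<inter> {Max F<..\<beta>} \<subseteq> - ?M"
        by force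
      moreover have "Max F < \<beta>"
        using F by auto
      ultimately show ?thesis
        by blast
    next
      case 2
      then show ?thesis
        using bot_less_limit[OF \<beta>] by blast
    next
      case 3
      have "B \<beta> \<inter> {\<alpha><..\<beta>} \<subseteq> - ?M"
        using below by fastforce
      with 3 show ?thesis
        by blast
    qed
  qed
  moreover have "topspace \<tau> = UNIV"
    using as by (simp add: associated_sets_def)
  ultimately show ?thesis
    by (simp add: closedin_def Compl_eq_Diff_UNIV)
qed

lemma not_sigma_countably_compact_associated:
  assumes as: "associated_sets \<tau> B" and lad: "ladder_system L"
    and split: "ladders_split B L" and club: "witnesses_club L"
  shows "\<not> sigma_countably_compact \<tau>"
proof
  assume "sigma_countably_compact \<tau>"
  then obtain \<C> where \<C>: "countable \<C>" "\<Union>\<C> = topspace \<tau>"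
    and cc: "\<And>C. C \<in> \<C> \<Longrightarrow> countably_compact_space (subtopology \<tau> C)"
    by (auto simp: sigma_countably_compact_def)
  have "topspace \<tau> = UNIV"
    using as by (simp add: associated_sets_def)
  then have "range osucc = (\<Union>C\<in>\<C>. C \<inter> range osucc)"
    using \<C>(2) by auto
  moreover have "uncountable (range osucc)"
    using uncountable_UNIV_omega1 inj_osucc countable_image_inj_on by blast
  ultimately obtain C where C: "C \<in> \<C>" "uncountable (C \<inter> range osucc)"
    using \<C>(1) countable_UN by (metis (no_types, lifting))
  then obtain \<alpha> where \<alpha>: "\<alpha> \<in> Lambda" and sub: "osucc ` L \<alpha> \<subseteq> C"
    using club_guesses_successors[OF club] by blast
  let ?M = "osucc ` L \<alpha> - B \<alpha>"
  have ladder: "ladder_at \<alpha> (L \<alpha>)"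
    using lad \<alpha> by (simp add: ladder_system_def)
  have below: "?M \<subseteq> {..<\<alpha>}"
    using ladder osucc_less_limit[OF \<alpha>] by (auto simp: ladder_at_def)
  have "\<not> countably_compact_space (subtopology \<tau> C)"
  proof (rule not_countably_compact_if_isolated_points)
    show "?M \<subseteq> C"
      using sub by auto
    show "infinite ?M"
      using split \<alpha> below by (intro infinite_if_Sup_eq_limit[OF \<alpha>]) (auto simp: ladders_split_def)
    show "countable ?M"
      using below countable_lessThan_omega1 countable_subset by blast
    show "closedin \<tau> ?M"
      by (rule closedin_shifted_ladder_outside[OF as \<alpha> ladder])
    show "openin \<tau> {a}" if "a \<in> ?M" for a
      using that osucc_notin_Lambda by (intro openin_singleton_if_not_limit[OF as]) auto
  qed
  with cc[OF C(1)] show False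
    by simp
qed

theorem theorem4p6:
  fixes \<tau> :: "omega1 topology"
    and B L :: "omega1 \<Rightarrow> omega1 set"
  assumes "\<tau> \<in> frakS"
    and "associated_sets \<tau> B"
    and "ladder_system L"
    and "ladders_split B L"
    and "witnesses_club L"
  shows "monotonically_normal_space \<tau> \<and> omega1_compact \<tau> \<and> \<not> sigma_countably_compact \<tau>"
  using monotonically_normal_associated[OF assms(2)] omega1_compact_associated[OF assms(2-5)]
    not_sigma_countably_compact_associated[OF assms(2-5)]
  by blast

end
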